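(* Let $\mathcal B$ be a separable complex Banach space, let $d\in\{1,2\}$, and let $X=\{X_t\}_{t\ge -d+1}$ be an I($d$) sequence in $\mathcal B$ with representation $\Delta^dX_t=\Theta(L)\varepsilon_t$, $t\ge 1$. Let $\mathfrak A(X)=\operatorname{ran}\Theta(1)$ be its attractor space and $\mathfrak C(X)\subset\mathcal B'$ its cointegrating space. Then the following hold. (i) $\mathfrak C(X)=\operatorname{Ann}(\mathfrak A(X))$. (ii) If $\mathcal B=\operatorname{cl}(\mathfrak A(X))\oplus V$ for some (closed) subspace $V\subset\mathcal B$, then $\mathfrak C(X)=\{f\circ \mathrm P_V: f\in\mathcal B'\}$, where $\mathrm P_V\in\mathcal L(\mathcal B)$ is the projection onto $V$ along $\operatorname{cl}(\mathfrak A(X))$, i.e. $\mathrm P_V=\mathrm P_V^2$, $\operatorname{ran}\mathrm P_V=V$, $\ker\mathrm P_V=\operatorname{cl}(\mathfrak A(X))$.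
   Context: $\mathcal L(\mathcal B)$ is the space of bounded linear operators on $\mathcal B$ with the operator norm $\|\cdot\|_{\rm op}$; $\mathcal B'$ is the topological dual; $\operatorname{cl}$ denotes closure; $\operatorname{Ann}(V)=\{f\in\mathcal B': f(x)=0\ \forall x\in V\}$. $\mathfrak L^2(\mathcal B)$ is the set of $\mathcal B$-valued random variables $Y$ with $EY=0$ and $E\|Y\|^2<\infty$; the covariance of $Y$ is $C_Y:\mathcal B'\to\mathcal B$, $C_Y(f)=E[f(Y)Y]$, and it is called positive definite if $f(C_Y(f))=0$ implies $f=0$. $L$ is the lag operator, $\Delta=I-L$, $\Delta^0=I$. I($d$), $d\in\{1,2\}$: the sequence $X\subset\mathfrak L^2(\mathcal B)$ satisfies $\Delta^dX_t=\Theta(L)\varepsilon_t=\sum_{j=0}^\infty\Theta_j\varepsilon_{t-j}$ for $t\ge1$, where $\{\varepsilon_t\}_{t\in\mathbb Z}$ is an iid sequence in $\mathfrak L^2(\mathcal B)$ with positive definite covariance, $\Theta_j\in\mathcal L(\mathcal B)$, $\sum_{j\ge 1} j^d\|\Theta_j\|_{\rm op}<\infty$ and $\Theta(1):=\sum_{j\ge0}\Theta_j\ne0$. Such an $X$ has the Beveridge–Nelson representation: for some $\tau_0$, $$\Delta^{d-1}X_t=\tau_0+\Theta(1)\sum_{s=1}^t\varepsilon_s+\nu_t,\qquad t\ge0,$$ where $\nu_t=-\sum_{j=0}^\infty\big(\sum_{k=j+1}^\infty\Theta_k\big)\varepsilon_{t-j}$ is stationary. The cointegrating space is $$\mathfrak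 C(X)=\{f\in\mathcal B':\ \{f(\Delta^{d-1}X_t)\}_{t\ge0}\text{ is stationary for some choice of }\tau_0\in\mathfrak L^2(\mathcal B)\},$$ where $\Delta^{d-1}X_t$ is given by the displayed representation and $\tau_0$ is free to be chosen. *)

theory Defs
  imports "HOL-Probability.Probability"
begin

section \<open>Complex Banach spaces, bounded operators and the dual\<close>

class complex_banach = banach +
  fixes scaleC :: "complex \<Rightarrow> 'a \<Rightarrow> 'a"  (infixr \<open>*\<^sub>C\<close> 75)
  assumes scaleC_add_right: "a *\<^sub>C (x + y) = a *\<^sub>C x + a *\<^sub>C y"
    and scaleC_add_left: "(a + b) *\<^sub>C x = a *\<^sub>C x + b *\<^sub>C x"
    and scaleC_scaleC: "a *\<^sub>C (b *\<^sub>C x) = (a * b) *\<^sub>C x"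
    and scaleR_scaleC: "r *\<^sub>R x = complex_of_real r *\<^sub>C x"
    and norm_scaleC: "norm (a *\<^sub>C x) = cmod a * norm x"

instantiation complex :: complex_banach
begin

definition scaleC_complex :: "complex \<Rightarrow> complex \<Rightarrow> complex"
  where "scaleC_complex a x = a * x"

instance
  by standard (auto simp: scaleC_complex_def algebra_simps norm_mult scaleR_conv_of_real)

end

text \<open>The type of bounded real-linear maps carries the operator norm and composition; the bounded
  complex-linear operators are a closed subset of it, with the same operator norm.\<close>

definition bounded_clinear_ops :: "('a::complex_banach \<Rightarrow>\<^sub>L 'b::complex_banach) set"
  where "bounded_clinear_ops =
    {T. \<forall>c x. blinfun_apply T (c *\<^sub>C x) = c *\<^sub>C blinfun_apply T x}"

definition dual_space :: "('a::complex_banach \<Rightarrow>\<^sub>L complex) set"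
  where "dual_space = bounded_clinear_ops"

definition annihilator :: "'a::complex_banach set \<Rightarrow> ('a \<Rightarrow>\<^sub>L complex) set"
  where "annihilator V = {f \<in> dual_space. \<forall>x\<in>V. blinfun_apply f x = 0}"

definition csubspace :: "'a::complex_banach set \<Rightarrow> bool"
  where "csubspace V \<longleftrightarrow>
    0 \<in> V \<and> (\<forall>x\<in>V. \<forall>y\<in>V. x + y \<in> V) \<and> (\<forall>c. \<forall>x\<in>V. c *\<^sub>C x \<in> V)"

definition direct_sum_decomp :: "'a::complex_banach set \<Rightarrow> 'a set \<Rightarrow> bool"
  where "direct_sum_decomp W V \<longleftrightarrow>
    csubspace W \<and> csubspace V \<and> W \<inter> V = {0} \<and> (\<forall>x. \<exists>w\<in>W. \<exists>v\<in>V. x = w + v)"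

definition is_projection_along ::
    "('a::complex_banach \<Rightarrow>\<^sub>L 'a) \<Rightarrow> 'a set \<Rightarrow> 'a set \<Rightarrow> bool"
  where "is_projection_along P V W \<longleftrightarrow>
    P \<in> bounded_clinear_ops \<and> P o\<^sub>L P = P \<and> range (blinfun_apply P) = V \<and>
    {x. blinfun_apply P x = 0} = W"


section \<open>Random elements of a Banach space\<close>

definition L2_mean_zero ::
    "'w measure \<Rightarrow> ('w \<Rightarrow> 'a::{banach, second_countable_topology}) set"
  where "L2_mean_zero M =
    {Y \<in> borel_measurable M. integrable M (\<lambda>\<omega>. (norm (Y \<omega>))\<^sup>2) \<and> (\<integral>\<omega>. Y \<omega> \<partial>M) = 0}"

text \<open>The parameter \<open>\<sigma>\<close> is meant to be the identity or complex conjugation. With \<open>\<sigma> = id\<close> this is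
  \<open>E[f(Y)Y]\<close>, so that \<open>f(C\<^sub>Y(f)) = E[f(Y)\<^sup>2]\<close>. Over the complex numbers this is a quadratic form
  in \<open>f\<close>, which has a nontrivial zero as soon as the dual has dimension at least two, so in that
  case no \<open>Y\<close> is positive definite. With \<open>\<sigma> = cnj\<close> one gets \<open>f(C\<^sub>Y(f)) = E\<bar>f(Y)\<bar>\<^sup>2\<close>, for which
  positive definiteness is a genuine non-degeneracy condition in every dimension; it is implied
  by positive definiteness for \<open>\<sigma> = id\<close>.\<close>

definition covariance ::
    "(complex \<Rightarrow> complex) \<Rightarrow> 'w measure \<Rightarrow> ('w \<Rightarrow> 'a::{complex_banach, second_countable_topology})
      \<Rightarrow> ('a \<Rightarrow>\<^sub>L complex) \<Rightarrow> 'a"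
  where "covariance \<sigma> M Y f = (\<integral>\<omega>. \<sigma> (blinfun_apply f (Y \<omega>)) *\<^sub>C Y \<omega> \<partial>M)"

definition pos_def_covariance ::
    "(complex \<Rightarrow> complex) \<Rightarrow> 'w measure \<Rightarrow> ('w \<Rightarrow> 'a::{complex_banach, second_countable_topology})
      \<Rightarrow> bool"
  where "pos_def_covariance \<sigma> M Y \<longleftrightarrow>
    (\<forall>f\<in>dual_space. blinfun_apply f (covariance \<sigma> M Y f) = 0 \<longrightarrow> f = 0)"

definition iid :: "'w measure \<Rightarrow> (int \<Rightarrow> 'w \<Rightarrow> 'a::topological_space) \<Rightarrow> bool"
  where "iid M \<epsilon> \<longleftrightarrow>
    prob_space.indep_vars M (\<lambda>_. borel) \<epsilon> UNIV \<and>
    (\<forall>s t. distr M borel (\<epsilon> s) = distr M borel (\<epsilon> t))"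

text \<open>Strict stationarity: all finite-dimensional distributions are invariant under time shifts.\<close>

definition stationary :: "'w measure \<Rightarrow> (nat \<Rightarrow> 'w \<Rightarrow> 'a::topological_space) \<Rightarrow> bool"
  where "stationary M Y \<longleftrightarrow>
    (\<forall>t. Y t \<in> borel_measurable M) \<and>
    (\<forall>J h. finite J \<longrightarrow>
      distr M (\<Pi>\<^sub>M i\<in>J. borel) (\<lambda>\<omega>. \<lambda>i\<in>J. Y (i + h) \<omega>) =
      distr M (\<Pi>\<^sub>M i\<in>J. borel) (\<lambda>\<omega>. \<lambda>i\<in>J. Y i \<omega>))"


section \<open>Integrated processes\<close>

definition lag :: "(int \<Rightarrow> 'w \<Rightarrow> 'a) \<Rightarrow> int \<Rightarrow> 'w \<Rightarrow> 'a"
  where "lag X t = X (t - 1)"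

definition lag_diff :: "(int \<Rightarrow> 'w \<Rightarrow> 'a::ab_group_add) \<Rightarrow> int \<Rightarrow> 'w \<Rightarrow> 'a"
  where "lag_diff X t \<omega> = X t \<omega> - lag X t \<omega>"

definition long_run :: "(nat \<Rightarrow> 'a::complex_banach \<Rightarrow>\<^sub>L 'a) \<Rightarrow> 'a \<Rightarrow>\<^sub>L 'a"
  where "long_run \<Theta> = (\<Sum>j. \<Theta> j)"

definition attractor_space :: "(nat \<Rightarrow> 'a::complex_banach \<Rightarrow>\<^sub>L 'a) \<Rightarrow> 'a set"
  where "attractor_space \<Theta> = range (blinfun_apply (long_run \<Theta>))"

text \<open>The linear process converges absolutely almost surely and in \<open>L\<^sup>2\<close>, by the summability of
  the operator norms. The index set of \<open>X\<close> is \<open>{1 - d..}\<close>; values of \<open>X\<close> at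
  earlier times are irrelevant.\<close>

definition integrated_process ::
    "(complex \<Rightarrow> complex) \<Rightarrow> 'w measure \<Rightarrow> nat \<Rightarrow>
      (nat \<Rightarrow> 'a::{complex_banach, second_countable_topology} \<Rightarrow>\<^sub>L 'a) \<Rightarrow>
      (int \<Rightarrow> 'w \<Rightarrow> 'a) \<Rightarrow> (int \<Rightarrow> 'w \<Rightarrow> 'a) \<Rightarrow> bool"
  where "integrated_process \<sigma> M d \<Theta> \<epsilon> X \<longleftrightarrow>
    (\<forall>t \<ge> 1 - int d. X t \<in> L2_mean_zero M) \<and>
    (\<forall>t. \<epsilon> t \<in> L2_mean_zero M) \<and>
    iid M \<epsilon> \<and>
    (\<forall>t. pos_def_covariance \<sigma> M (\<epsilon> t)) \<and>
    (\<forall>j. \<Theta> j \<in> bounded_clinear_ops) \<and>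
    summable (\<lambda>j. real j ^ d * norm (\<Theta> j)) \<and>
    long_run \<Theta> \<noteq> 0 \<and>
    (\<forall>t \<ge> 1. AE \<omega> in M.
      (\<lambda>j. blinfun_apply (\<Theta> j) (\<epsilon> (t - int j) \<omega>)) sums ((lag_diff ^^ d) X t \<omega>))"

definition BN_noise ::
    "(nat \<Rightarrow> 'a::complex_banach \<Rightarrow>\<^sub>L 'a) \<Rightarrow> (int \<Rightarrow> 'w \<Rightarrow> 'a) \<Rightarrow> int \<Rightarrow> 'w \<Rightarrow> 'a"
  where "BN_noise \<Theta> \<epsilon> t \<omega> =
    - (\<Sum>j. blinfun_apply (\<Sum>k. \<Theta> (j + 1 + k)) (\<epsilon> (t - int j) \<omega>))"

text \<open>The Beveridge--Nelson representation of the \<open>(d - 1)\<close>-st difference of \<open>X\<close>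
  with initial condition \<open>\<tau>\<close>.\<close>

definition BN_representation ::
    "(nat \<Rightarrow> 'a::complex_banach \<Rightarrow>\<^sub>L 'a) \<Rightarrow> (int \<Rightarrow> 'w \<Rightarrow> 'a) \<Rightarrow> ('w \<Rightarrow> 'a) \<Rightarrow> nat \<Rightarrow> 'w \<Rightarrow> 'a"
  where "BN_representation \<Theta> \<epsilon> \<tau> t \<omega> =
    \<tau> \<omega> + blinfun_apply (long_run \<Theta>) (\<Sum>s = 1..int t. \<epsilon> s \<omega>) + BN_noise \<Theta> \<epsilon> (int t) \<omega>"

text \<open>Since the initial condition is free, the cointegrating space depends on the process only
  through \<open>\<Theta>\<close> and \<open>\<epsilon>\<close>.\<close>

definition cointegrating_space ::
    "'w measure \<Rightarrow> (nat \<Rightarrow> 'a::{complex_banach, second_countable_topology} \<Rightarrow>\<^sub>L 'a) \<Rightarrow>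
      (int \<Rightarrow> 'w \<Rightarrow> 'a) \<Rightarrow> ('a \<Rightarrow>\<^sub>L complex) set"
  where "cointegrating_space M \<Theta> \<epsilon> =
    {f \<in> dual_space. \<exists>\<tau> \<in> L2_mean_zero M.
      stationary M (\<lambda>t \<omega>. blinfun_apply f (BN_representation \<Theta> \<epsilon> \<tau> t \<omega>))}"

end

theory Submission
  imports Defs
begin

text \<open>If \<open>f\<close> annihilates the attractor space, the random walk component drops out of \<open>f\<close> applied to
  the Beveridge--Nelson representation, and with \<open>\<tau> = 0\<close> what remains is a fixed measurable
  functional of the shifted i.i.d. path, hence strictly stationary. Conversely, if \<open>f\<close> of the
  representation is stationary for some \<open>\<tau>\<close>, then its second moment does not depend on \<open>t\<close>; neither
  do those of \<open>f(\<tau>)\<close> and \<open>f(\<nu>\<^sub>t)\<close>. Hence the random walk with increments \<open>f(\<Theta>(1)\<epsilon>\<^sub>s)\<close> is bounded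
  in \<open>L\<^sup>2\<close>, whereas its second moment grows linearly in \<open>t\<close>. So the increments vanish almost surely,
  and positive definiteness of the covariance gives \<open>f \<circ> \<Theta>(1) = 0\<close>.

  The projection along a closed complement is bounded by the closed graph theorem.\<close>

section \<open>Bounded projections along closed complements\<close>

text \<open>By Baire, some sublevel set of \<open>norm (f x)\<close> is dense in a ball. Symmetry
  and convexity move the ball to the origin, so every vector is approximable by vectors on which
  \<open>f\<close> is controlled. Summing successive corrections and using the closed graph turns
  this into a bound on \<open>f\<close> itself.\<close>

lemma closed_graph_bounded_linear:
  fixes f :: "'a::banach \<Rightarrow> 'b::banach"
  assumes "linear f" and closed: "closed {(x, f x) | x. True}"
  shows "bounded_linear f"
proof -
  interpret linear f by fact
  define E where "E n = closure {x. norm (f x) \<le> real n}" for n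
  have "(\<Union>n. E n) = UNIV"
  proof -
    have "x \<in> E (nat \<lceil>norm (f x)\<rceil>)" for x
      unfolding E_def by (rule subsetD[OF closure_subset]) (simp add: real_nat_ceiling_ge)
    then show ?thesis by blast
  qed
  \<comment> \<open>Countably many closed sets with empty interior cannot cover a Banach
    space.\<close>
  then have "\<exists>n. interior (E n) \<noteq> {}"
    using Baire_category_alt[of "euclidean :: 'a topology" "range E"]
    by (auto simp: completely_metrizable_space_euclidean E_def)
  then obtain n z where "z \<in> interior (E n)" by blast
  then obtain r where "r > 0" and r: "ball z r \<subseteq> E n"
    using mem_interior by blast
  \<comment> \<open>Since \<open>h\<close> is half the difference of \<open>z + h\<close> and
    \<open>z - h\<close>, the unknown centre \<open>z\<close> cancels, and half the difference of
    two approximants keeps the bound \<open>n\<close>.\<close>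
  have approx0: "\<exists>y. norm (h - y) < \<delta> \<and> norm (f y) \<le> real n" if h: "norm h < r" and "\<delta> > 0" for h \<delta>
  proof -
    have "z + h \<in> E n" "z - h \<in> E n"
      using r h by (auto simp: dist_norm)
    then obtain a b where a: "norm (f a) \<le> n" "dist a (z + h) < \<delta>" and b: "norm (f b) \<le> n" "dist b (z - h) < \<delta>"
      using \<open>\<delta> > 0\<close> unfolding E_def closure_approachable by blast
    let ?y = "(1/2) *\<^sub>R (a - b)"
    have "h - ?y = (1/2) *\<^sub>R ((z + h - a) - (z - h - b))"
      by (simp add: algebra_simps flip: scaleR_2)
    then have "norm (h - ?y) \<le> (1/2) * (norm (z + h - a) + norm (z - h - b))"
      using norm_triangle_ineq4[of "z + h - a" "z - h - b"] by (simp only: norm_scaleR) simp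
    also have "\<dots> < \<delta>" using a(2) b(2) by (simp add: dist_norm norm_minus_commute)
    finally have 1: "norm (h - ?y) < \<delta>" .
    have "norm (f ?y) = (1/2) * norm (f a - f b)" by (simp add: scale diff)
    also have "\<dots> \<le> (1/2) * (norm (f a) + norm (f b))" by (simp add: norm_triangle_ineq4)
    also have "\<dots> \<le> n" using a b by simp
    finally show ?thesis using 1 by blast
  qed
  \<comment> \<open>Scaling by \<open>c = r / (2 * s)\<close> shrinks a vector of norm at most
    \<open>s\<close> into the ball of radius \<open>r\<close>; undoing it turns the bound
    \<open>n\<close> into \<open>n / c = K * s\<close>.\<close>
  define K where "K = 2 * real n / r"
  have approx: "\<exists>y. norm (x - y) \<le> s / 2 \<and> norm (f y) \<le> K * s" if x: "norm x \<le> s" for x s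
  proof (cases "s > 0")
    case False
    then have "norm x = 0" "s = 0" using x norm_ge_zero[of x] by linarith+
    then have "x = 0" by simp
    with \<open>s = 0\<close> show ?thesis by (intro exI[of _ 0]) (simp add: zero)
  next
    case True
    define c where "c = r / (2 * s)"
    have "c > 0" using True \<open>r > 0\<close> by (simp add: c_def)
    have "norm (c *\<^sub>R x) \<le> c * s" using x \<open>c > 0\<close> by simp
    also have "\<dots> < r" using True \<open>r > 0\<close> by (simp add: c_def)
    finally obtain y where y: "norm (c *\<^sub>R x - y) < c * (s / 2)" "norm (f y) \<le> n"
      using approx0[of "c *\<^sub>R x" "c * (s / 2)"] \<open>c > 0\<close> True by auto
    have "x - y /\<^sub>R c = (c *\<^sub>R x - y) /\<^sub>R c" using \<open>c > 0\<close> by (simp add: scaleR_diff_right)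
    then have "norm (x - y /\<^sub>R c) = norm (c *\<^sub>R x - y) / c" using \<open>c > 0\<close> by (simp add: divide_inverse_commute)
    also have "\<dots> \<le> s / 2" using y(1) \<open>c > 0\<close> by (simp add: field_simps)
    finally have 1: "norm (x - y /\<^sub>R c) \<le> s / 2" .
    have "norm (f (y /\<^sub>R c)) = norm (f y) / c" using \<open>c > 0\<close> by (simp add: scale divide_inverse_commute)
    also have "\<dots> \<le> n / c" using y(2) \<open>c > 0\<close> by (simp add: divide_right_mono)
    also have "\<dots> = K * s" using True \<open>r > 0\<close> by (simp add: K_def c_def)
    finally show ?thesis using 1 by blast
  qed
  define g where "g x s = (SOME y. norm (x - y) \<le> s / 2 \<and> norm (f y) \<le> K * s)" for x s
  have g: "norm (x - g x s) \<le> s / 2" "norm (f (g x s)) \<le> K * s" if "norm x \<le> s" for x s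
    using someI_ex[OF approx[OF that]] by (auto simp: g_def)
  have "norm (f x) \<le> norm x * (2 * K)" for x
  proof -
    let ?s = "\<lambda>k. norm x * (1/2) ^ k"
    \<comment> \<open>\<open>res k\<close> is what remains of \<open>x\<close> after
      \<open>k\<close> corrections \<open>y\<close>. Its norm bound halves each time, so the
      corrections telescope to \<open>x\<close>.\<close>
    define res where "res = rec_nat x (\<lambda>k v. v - g v (?s k))"
    define y where "y k = g (res k) (?s k)" for k
    have res_Suc: "res (Suc k) = res k - y k" and res_0: "res 0 = x" for k
      by (simp_all add: res_def y_def)
    have res: "norm (res k) \<le> ?s k" for k
    proof (induction k)
      case (Suc k)
      then show ?case using g(1)[of "res k" "?s k"] by (simp add: res_Suc y_def)
    qed (simp add: res_0)
    have fy: "norm (f (y k)) \<le> K * ?s k" for k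
      unfolding y_def by (intro g(2) res)
    have sumy: "(\<Sum>i<k. y i) = x - res k" for k
      by (induction k) (auto simp: res_0 res_Suc)
    have geo: "?s sums (norm x * 2)"
      using sums_mult[OF geometric_sums[of "1/2::real"], of "norm x"] by simp
    have "res \<longlonglongrightarrow> 0"
      by (rule Lim_null_comparison[of res ?s, OF _ summable_LIMSEQ_zero[OF sums_summable[OF geo]]])
         (simp add: res)
    then have "(\<lambda>k. \<Sum>i<k. y i) \<longlonglongrightarrow> x - 0"
      unfolding sumy by (intro tendsto_intros)
    moreover
    have geoK: "(\<lambda>k. K * ?s k) sums (K * (norm x * 2))" by (intro sums_mult geo)
    have sf: "summable (\<lambda>k. norm (f (y k)))"
      by (rule summable_comparison_test'[OF sums_summable[OF geoK], of 0]) (simp add: fy)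
    then have sf': "summable (\<lambda>k. f (y k))" by (rule summable_norm_cancel)
    define w where "w = (\<Sum>k. f (y k))"
    have "(\<lambda>k. f (\<Sum>i<k. y i)) \<longlonglongrightarrow> w"
      using sf' unfolding sum w_def by (simp add: summable_LIMSEQ)
    \<comment> \<open>These pairs lie on the graph and converge, so closedness identifies
      \<open>w\<close> with \<open>f x\<close>; the geometric series bounds
      \<open>w\<close>.\<close>
    ultimately have "(\<lambda>k. ((\<Sum>i<k. y i), f (\<Sum>i<k. y i))) \<longlonglongrightarrow> (x, w)"
      by (intro tendsto_Pair) auto
    from closed_sequentially[OF closed _ this] have "w = f x" by auto
    moreover have "norm w \<le> K * (norm x * 2)"
      unfolding w_def using suminf_le[OF fy sf sums_summable[OF geoK]] summable_norm[OF sf] sums_unique[OF geoK]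
      by simp
    ultimately show ?thesis by (simp add: mult_ac)
  qed
  then show ?thesis
    by (intro bounded_linear_intro[of f "2 * K"]) (auto simp: add scale)
qed

text \<open>The \<open>V\<close>-component of a vector is unique because \<open>W\<close> and
  \<open>V\<close> meet only in 0. Closedness of both subspaces makes its graph closed, and the
  closed graph theorem supplies boundedness.\<close>

lemma direct_sum_projection_exists:
  fixes W V :: "'a::complex_banach set"
  assumes "closed W" "closed V" and dec: "direct_sum_decomp W V"
  shows "\<exists>P. is_projection_along P V W"
proof -
  have W: "csubspace W" and V: "csubspace V" and WV: "W \<inter> V = {0}"
    and ex: "\<And>x. \<exists>v\<in>V. x - v \<in> W"
    using dec unfolding direct_sum_decomp_def by (auto, metis add_diff_cancel_right')
  have sub: "x - y \<in> S" if "csubspace S" "x \<in> S" "y \<in> S" for x y :: 'a and S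
  proof -
    have "x + (-1) *\<^sub>C y \<in> S" using that by (auto simp: csubspace_def)
    moreover have "(-1) *\<^sub>C y = (-1::real) *\<^sub>R y" unfolding scaleR_scaleC by simp
    ultimately show ?thesis by simp
  qed
  have uniq: "v = v'" if "v \<in> V" "x - v \<in> W" "v' \<in> V" "x - v' \<in> W" for x v v'
  proof -
    have "v - v' \<in> V" using sub[OF V] that by blast
    moreover have "v - v' \<in> W" using sub[OF W that(4) that(2)] by simp
    ultimately have "v - v' = 0" using WV by blast
    then show ?thesis by simp
  qed
  define p where "p x = (SOME v. v \<in> V \<and> x - v \<in> W)" for x
  have p_both: "p x \<in> V \<and> x - p x \<in> W" for x
    unfolding p_def by (rule someI_ex) (use ex[of x] in blast)
  have p: "p x \<in> V" "x - p x \<in> W" for x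
    using p_both by blast+
  have pI: "p x = v" if "v \<in> V" "x - v \<in> W" for x v
    using uniq p that by blast
  have p_add: "p (x + y) = p x + p y" for x y
  proof (rule pI)
    show "p x + p y \<in> V" using V p by (auto simp: csubspace_def)
    have "(x - p x) + (y - p y) \<in> W" using W p unfolding csubspace_def by blast
    then show "x + y - (p x + p y) \<in> W" by (simp add: algebra_simps)
  qed
  have p_scale: "p (c *\<^sub>C x) = c *\<^sub>C p x" for c x
  proof (rule pI)
    show "c *\<^sub>C p x \<in> V" using V p by (auto simp: csubspace_def)
    have "c *\<^sub>C (x - p x) \<in> W" using W p by (auto simp: csubspace_def)
    moreover have "c *\<^sub>C (x - p x) + c *\<^sub>C p x = c *\<^sub>C x" by (simp flip: scaleC_add_right)
    ultimately show "c *\<^sub>C x - c *\<^sub>C p x \<in> W" by (metis add_diff_cancel_right')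
  qed
  \<comment> \<open>Real linearity is what the closed graph theorem asks for; complex homogeneity
    \<open>p_scale\<close> returns when \<open>P\<close> is shown to be an element of
    \<open>bounded_clinear_ops\<close>.\<close>
  have "linear p"
    by (rule linearI) (auto simp: p_add p_scale scaleR_scaleC)
  \<comment> \<open>Membership in the graph becomes two conditions that are visibly closed.\<close>
  moreover have "{(x, p x) |x. True} = {z. snd z \<in> V \<and> fst z - snd z \<in> W}"
  proof (rule set_eqI)
    fix z :: "'a \<times> 'a"
    obtain x v where z: "z = (x, v)" by (cases z)
    have "z \<in> {(x, p x) |x. True} \<longleftrightarrow> v = p x" by (auto simp: z)
    also have "\<dots> \<longleftrightarrow> v \<in> V \<and> x - v \<in> W" using p[of x] pI[of v x] by metis
    finally show "z \<in> {(x, p x) |x. True} \<longleftrightarrow> z \<in> {z. snd z \<in> V \<and> fst z - snd z \<in> W}"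
      by (simp add: z)
  qed
  moreover have "closed {z. snd z \<in> V \<and> fst z - snd z \<in> W}"
  proof -
    have "closed (snd -` V \<inter> (\<lambda>z. fst z - snd z) -` W)"
      by (intro closed_Int closed_vimage assms continuous_intros)
    then show ?thesis by (simp add: vimage_def Int_def)
  qed
  ultimately have bl: "bounded_linear p"
    using closed_graph_bounded_linear by metis
  define P where "P = Blinfun p"
  have P: "blinfun_apply P = p" by (simp add: P_def bounded_linear_Blinfun_apply bl)
  have pV: "p v = v" if "v \<in> V" for v using pI[OF that] W by (simp add: csubspace_def)
  have "is_projection_along P V W"
    unfolding is_projection_along_def bounded_clinear_ops_def
  proof (intro conjI)
    show "P \<in> {T. \<forall>c x. blinfun_apply T (c *\<^sub>C x) = c *\<^sub>C blinfun_apply T x}" by (simp add: P p_scale)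
    show "P o\<^sub>L P = P" by (rule blinfun_eqI) (simp add: P pV p)
    show "range (blinfun_apply P) = V" using p pV by (auto simp: P) (metis rangeI)
    have "p x = 0" if "x \<in> W" for x using pI[of 0 x] V that by (simp add: csubspace_def)
    then show "{x. blinfun_apply P x = 0} = W" using p(2) by (auto simp: P) (metis diff_zero)
  qed
  then show ?thesis by blast
qed

text \<open>\<open>Q\<close> kills \<open>x - P x\<close>, which lies in the common kernel, and
  fixes \<open>P x\<close>, which lies in the common range.\<close>

lemma projection_along_unique:
  assumes P: "is_projection_along P V W" and Q: "is_projection_along Q V W"
  shows "P = Q"
proof (rule blinfun_eqI)
  fix x
  have PP: "P (P x) = P x" and QQ: "Q (Q y) = Q y" for y
    using P Q unfolding is_projection_along_def by (metis blinfun_apply_blinfun_compose)+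
  have "P (x - P x) = 0" by (simp add: blinfun.diff_right PP)
  then have "x - P x \<in> W" using P unfolding is_projection_along_def by blast
  then have "Q (x - P x) = 0" using Q unfolding is_projection_along_def by blast
  then have "Q x = Q (P x)" by (simp add: blinfun.diff_right)
  moreover have "P x \<in> range Q" using P Q unfolding is_projection_along_def by auto
  then have "Q (P x) = P x" using QQ by auto
  ultimately show "P x = Q x" by simp
qed

text \<open>By continuity, a functional vanishing on \<open>A\<close> vanishes on
  \<open>closure A\<close>, the kernel of \<open>P\<close>, hence on every \<open>x - P x\<close>;
  so it equals its own composite with \<open>P\<close>. Conversely, \<open>P\<close> already kills
  \<open>A\<close>.\<close>

lemma annihilator_eq_compose_projection:
  assumes P: "is_projection_along P V (closure A)"
  shows "annihilator A = {f o\<^sub>L P | f. f \<in> dual_space}"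
proof (intro set_eqI iffI)
  have PP: "P (P x) = P x" and clin: "P (c *\<^sub>C x) = c *\<^sub>C P x" for x c
    using P unfolding is_projection_along_def bounded_clinear_ops_def
    by (metis blinfun_apply_blinfun_compose, blast)
  have ker: "P x = 0 \<longleftrightarrow> x \<in> closure A" for x
    using P unfolding is_projection_along_def by blast
  fix f
  {
    assume f: "f \<in> annihilator A"
    have "closed {x. f x = 0}" by (intro closed_Collect_eq continuous_intros)
    moreover have "A \<subseteq> {x. f x = 0}" using f by (auto simp: annihilator_def)
    ultimately have zero: "f x = 0" if "x \<in> closure A" for x
      using closure_minimal that by blast
    have "f = f o\<^sub>L P"
    proof (rule blinfun_eqI)
      fix x
      have "P (x - P x) = 0" by (simp add: blinfun.diff_right PP)
      then have "f (x - P x) = 0" using ker zero by blast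
      then show "f x = (f o\<^sub>L P) x" by (simp add: blinfun.diff_right)
    qed
    with f show "f \<in> {f o\<^sub>L P | f. f \<in> dual_space}" unfolding annihilator_def by blast
  next
    assume "f \<in> {f o\<^sub>L P | f. f \<in> dual_space}"
    then obtain g where g: "g \<in> dual_space" "f = g o\<^sub>L P" by blast
    have "f \<in> dual_space" using g clin by (simp add: dual_space_def bounded_clinear_ops_def)
    moreover have "f x = 0" if "x \<in> A" for x
      using ker[of x] closure_subset that g by (auto simp: blinfun.zero_right)
    ultimately show "f \<in> annihilator A" by (simp add: annihilator_def)
  }
qed


section \<open>Stationarity and second moments\<close>

text \<open>The law of the whole path is an infinite power of the single marginal \<open>N\<close>,
  and a power of one measure is invariant under injective reindexing of its coordinates.\<close>

lemma iid_path_shift: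
  fixes \<epsilon> :: "int \<Rightarrow> 'w \<Rightarrow> 'a::topological_space"
  assumes "prob_space M" and iid: "iid M \<epsilon>"
  shows "distr M (\<Pi>\<^sub>M i\<in>UNIV. borel) (\<lambda>\<omega> i. \<epsilon> (i + h) \<omega>) = distr M (\<Pi>\<^sub>M i\<in>UNIV. borel) (\<lambda>\<omega> i. \<epsilon> i \<omega>)"
proof -
  interpret prob_space M by fact
  define N where "N = distr M borel (\<epsilon> 0)"
  have ind: "indep_vars (\<lambda>_. borel) \<epsilon> UNIV" and dist: "distr M borel (\<epsilon> t) = N" for t
    using iid unfolding iid_def N_def by auto
  have meas: "\<epsilon> t \<in> borel_measurable M" for t
    using ind unfolding indep_vars_def by auto
  have path_meas: "(\<lambda>\<omega> i. \<epsilon> i \<omega>) \<in> measurable M (\<Pi>\<^sub>M i\<in>UNIV. borel)"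
    by (rule measurable_PiM_single') (auto simp: meas)
  have N: "prob_space N" "sets N = sets borel"
    unfolding N_def using prob_space_distr[OF meas] by auto
  let ?P = "\<Pi>\<^sub>M i\<in>(UNIV::int set). N"
  have sets_P: "sets ?P = sets (\<Pi>\<^sub>M i\<in>(UNIV::int set). borel)"
    by (rule sets_PiM_cong) (auto simp: N)
  have law: "distr M (\<Pi>\<^sub>M i\<in>UNIV. borel) (\<lambda>\<omega> i. \<epsilon> i \<omega>) = ?P"
    using indep_vars_iff_distr_eq_PiM[of UNIV \<epsilon> "\<lambda>_. borel"] ind meas by (simp add: dist restrict_UNIV)
  have "distr M (\<Pi>\<^sub>M i\<in>UNIV. borel) (\<lambda>\<omega> i. \<epsilon> (i + h) \<omega>) =
      distr (distr M (\<Pi>\<^sub>M i\<in>UNIV. borel) (\<lambda>\<omega> i. \<epsilon> i \<omega>)) (\<Pi>\<^sub>M i\<in>UNIV. borel) (\<lambda>p i. p (i + h))"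
    by (subst distr_distr) (auto simp: comp_def intro!: path_meas measurable_PiM_single')
  \<comment> \<open>The product of the \<open>borel\<close> spaces is exchanged for
    \<open>?P\<close>, which has the same measurable sets, to match the form of the reindexing
    theorem.\<close>
  also have "\<dots> = distr ?P ?P (\<lambda>p. \<lambda>i\<in>UNIV. p (i + h))"
    unfolding law by (rule distr_cong) (auto simp: sets_P)
  also have "\<dots> = ?P"
    by (rule distr_PiM_reindex) (auto simp: N inj_on_def)
  finally show ?thesis by (simp add: law)
qed

text \<open>A shifted finite-dimensional vector is one fixed measurable map \<open>?G\<close> of the
  shifted path, so invariance of the path law carries over.\<close>

lemma stationary_path_functional:
  fixes \<epsilon> :: "int \<Rightarrow> 'w \<Rightarrow> 'a::topological_space" and F :: "(int \<Rightarrow> 'a) \<Rightarrow> 'c::topological_space"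
  assumes "prob_space M" and iid: "iid M \<epsilon>"
    and F: "F \<in> borel_measurable (\<Pi>\<^sub>M i\<in>UNIV. borel)"
  shows "stationary M (\<lambda>t \<omega>. F (\<lambda>i. \<epsilon> (i + int t) \<omega>))"
  unfolding stationary_def
proof (intro conjI allI impI)
  interpret prob_space M by fact
  let ?B = "\<Pi>\<^sub>M i\<in>(UNIV::int set). (borel :: 'a measure)"
  have meas: "\<epsilon> t \<in> borel_measurable M" for t
    using iid unfolding iid_def indep_vars_def by auto
  have path: "(\<lambda>\<omega> i. \<epsilon> (i + k) \<omega>) \<in> measurable M ?B" for k
    by (rule measurable_PiM_single') (auto simp: meas)
  show "(\<lambda>\<omega>. F (\<lambda>i. \<epsilon> (i + int t) \<omega>)) \<in> borel_measurable M" for t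
    using measurable_compose[OF path F] .
  fix J :: "nat set" and h :: nat
  let ?G = "\<lambda>p. \<lambda>i\<in>J. F (\<lambda>k. p (k + int i))"
  have shift: "(\<lambda>p i. p (i + k)) \<in> measurable ?B ?B" for k
    by (rule measurable_PiM_single') auto
  have G: "?G \<in> measurable ?B (\<Pi>\<^sub>M i\<in>J. borel)"
    by (intro measurable_restrict measurable_compose[OF shift F])
  have "distr M (\<Pi>\<^sub>M i\<in>J. borel) (\<lambda>\<omega>. \<lambda>i\<in>J. F (\<lambda>k. \<epsilon> (k + int (i + h)) \<omega>)) =
      distr (distr M ?B (\<lambda>\<omega> i. \<epsilon> (i + int h) \<omega>)) (\<Pi>\<^sub>M i\<in>J. borel) ?G"
    by (subst distr_distr[OF G path]) (simp add: comp_def add.assoc)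
  \<comment> \<open>The shift by 0 keeps the unshifted path in the form to which \<open>path\<close>
    applies.\<close>
  also have "\<dots> = distr (distr M ?B (\<lambda>\<omega> i. \<epsilon> (i + 0) \<omega>)) (\<Pi>\<^sub>M i\<in>J. borel) ?G"
    by (simp add: iid_path_shift[OF assms(1) iid])
  also have "\<dots> = distr M (\<Pi>\<^sub>M i\<in>J. borel) (\<lambda>\<omega>. \<lambda>i\<in>J. F (\<lambda>k. \<epsilon> (k + int i) \<omega>))"
    by (subst distr_distr[OF G path]) (simp add: comp_def)
  finally show "distr M (\<Pi>\<^sub>M i\<in>J. borel) (\<lambda>\<omega>. \<lambda>i\<in>J. F (\<lambda>k. \<epsilon> (k + int (i + h)) \<omega>)) =
      distr M (\<Pi>\<^sub>M i\<in>J. borel) (\<lambda>\<omega>. \<lambda>i\<in>J. F (\<lambda>k. \<epsilon> (k + int i) \<omega>))" .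
qed

text \<open>The one-dimensional laws are recovered from the index set \<open>{0}\<close> by
  projecting onto its only coordinate.\<close>

lemma stationary_distr:
  assumes "stationary M Y"
  shows "distr M borel (Y t) = distr M borel (Y 0)"
proof -
  have meas: "Y t \<in> borel_measurable M" for t
    using assms by (simp add: stationary_def)
  have vec: "(\<lambda>\<omega>. \<lambda>i\<in>{0}. Y (i + h) \<omega>) \<in> measurable M (\<Pi>\<^sub>M i\<in>{0}. borel)" for h :: nat
    by (intro measurable_restrict meas)
  have marg: "distr M borel (Y h) = distr (distr M (\<Pi>\<^sub>M i\<in>{0}. borel) (\<lambda>\<omega>. \<lambda>i\<in>{0}. Y (i + h) \<omega>)) borel (\<lambda>p. p 0)" for h
    by (subst distr_distr[OF _ vec]) (auto simp: comp_def)
  have "distr M (\<Pi>\<^sub>M i\<in>{0}. borel) (\<lambda>\<omega>. \<lambda>i\<in>{0}. Y (i + t) \<omega>) =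
      distr M (\<Pi>\<^sub>M i\<in>{0}. borel) (\<lambda>\<omega>. \<lambda>i\<in>{0}. Y (i + 0) \<omega>)"
    using assms[unfolded stationary_def, THEN conjunct2, rule_format, of "{0}" t] by simp
  then show ?thesis using marg by metis
qed

section \<open>Second moments of stationary sequences, operator series and independent sums\<close>

lemma stationary_second_moment:
  fixes Y :: "nat \<Rightarrow> 'w \<Rightarrow> 'a::{real_normed_vector, second_countable_topology}"
  assumes "stationary M Y" "integrable M (\<lambda>\<omega>. (norm (Y 0 \<omega>))\<^sup>2)"
  shows "integrable M (\<lambda>\<omega>. (norm (Y t \<omega>))\<^sup>2)"
    and "(\<integral>\<omega>. (norm (Y t \<omega>))\<^sup>2 \<partial>M) = (\<integral>\<omega>. (norm (Y 0 \<omega>))\<^sup>2 \<partial>M)"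
proof -
  have meas[measurable]: "Y t \<in> borel_measurable M" for t
    using assms(1) by (simp add: stationary_def)
  have *: "integrable M (\<lambda>\<omega>. (norm (Y h \<omega>))\<^sup>2) \<longleftrightarrow> integrable (distr M borel (Y h)) (\<lambda>x. (norm x)\<^sup>2)"
    "(\<integral>\<omega>. (norm (Y h \<omega>))\<^sup>2 \<partial>M) = (\<integral>x. (norm x)\<^sup>2 \<partial>distr M borel (Y h))" for h
    by (subst integrable_distr_eq, simp_all) (subst integral_distr, simp_all)
  show "integrable M (\<lambda>\<omega>. (norm (Y t \<omega>))\<^sup>2)"
    using assms(2) unfolding * stationary_distr[OF assms(1), of t] .
  show "(\<integral>\<omega>. (norm (Y t \<omega>))\<^sup>2 \<partial>M) = (\<integral>\<omega>. (norm (Y 0 \<omega>))\<^sup>2 \<partial>M)"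
    unfolding * stationary_distr[OF assms(1), of t] ..
qed

text \<open>Cauchy-Schwarz with each weight split into two square roots, passed from partial sums to
  the limit. The right side is linear in the squared norms, so its expectation can be taken term by
  term.\<close>

lemma norm_suminf_square_le:
  fixes x :: "nat \<Rightarrow> 'a::banach" and A :: "nat \<Rightarrow> 'a \<Rightarrow>\<^sub>L 'b::banach"
  assumes A: "summable (\<lambda>j. norm (A j))" and x: "summable (\<lambda>j. norm (A j) * (norm (x j))\<^sup>2)"
  shows "(norm (\<Sum>j. A j (x j)))\<^sup>2 \<le> (\<Sum>j. norm (A j)) * (\<Sum>j. norm (A j) * (norm (x j))\<^sup>2)"
proof -
  \<comment> \<open>Absolute convergence of the series follows from the two hypotheses through
    \<open>r \<le> 1 + r * r\<close>.\<close>
  have le: "norm (A j) * norm (x j) \<le> norm (A j) + norm (A j) * (norm (x j))\<^sup>2" for j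
  proof -
    have "norm (x j) \<le> 1 + (norm (x j))\<^sup>2"
      using sum_squares_bound[of "norm (x j)" 1] by (simp add: power2_eq_square) (smt (verit) norm_ge_zero)
    from mult_left_mono[OF this norm_ge_zero[of "A j"]] show ?thesis by (simp add: algebra_simps)
  qed
  have sum_le: "norm (A j (x j)) \<le> norm (A j) + norm (A j) * (norm (x j))\<^sup>2" for j
    using le norm_blinfun[of "A j" "x j"] by (rule order_trans[rotated])
  have "summable (\<lambda>j. norm (A j (x j)))"
    by (rule summable_comparison_test'[OF summable_add[OF A x], of 0]) (simp add: sum_le)
  then have lim: "(\<lambda>n. (norm (\<Sum>j<n. A j (x j)))\<^sup>2) \<longlonglongrightarrow> (norm (\<Sum>j. A j (x j)))\<^sup>2"
    by (intro tendsto_intros summable_LIMSEQ) (rule summable_norm_cancel)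
  show ?thesis
  proof (rule LIMSEQ_le_const2[OF lim], intro exI allI impI)
    fix n :: nat
    have "norm (\<Sum>j<n. A j (x j)) \<le> (\<Sum>j<n. sqrt (norm (A j)) * (sqrt (norm (A j)) * norm (x j)))"
      by (rule sum_norm_le) (simp add: norm_blinfun flip: mult.assoc)
    then have "(norm (\<Sum>j<n. A j (x j)))\<^sup>2 \<le> (\<Sum>j<n. sqrt (norm (A j)) * (sqrt (norm (A j)) * norm (x j)))\<^sup>2"
      by (intro power_mono) auto
    also have "\<dots> \<le> (\<Sum>j<n. (sqrt (norm (A j)))\<^sup>2) * (\<Sum>j<n. (sqrt (norm (A j)) * norm (x j))\<^sup>2)"
      by (rule Cauchy_Schwarz_ineq_sum)
    also have "\<dots> = (\<Sum>j<n. norm (A j)) * (\<Sum>j<n. norm (A j) * (norm (x j))\<^sup>2)"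
      by (simp add: power_mult_distrib)
    also have "\<dots> \<le> (\<Sum>j. norm (A j)) * (\<Sum>j. norm (A j) * (norm (x j))\<^sup>2)"
      by (intro mult_mono sum_le_suminf A x suminf_nonneg sum_nonneg) auto
    finally show "(norm (\<Sum>j<n. A j (x j)))\<^sup>2 \<le> (\<Sum>j. norm (A j)) * (\<Sum>j. norm (A j) * (norm (x j))\<^sup>2)" .
  qed
qed

text \<open>The pointwise bound \<open>norm_suminf_square_le\<close> dominates the square by a
  series whose expectation is finite by Tonelli and the uniform moment bound
  \<open>m\<close>.\<close>

lemma square_integrable_weighted_series:
  fixes Y :: "nat \<Rightarrow> 'w \<Rightarrow> 'a::{banach, second_countable_topology}"
    and A :: "nat \<Rightarrow> 'a \<Rightarrow>\<^sub>L 'b::{banach, second_countable_topology}"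
  assumes A: "summable (\<lambda>j. norm (A j))"
    and [measurable]: "\<And>j. Y j \<in> borel_measurable M"
    and Y: "\<And>j. integrable M (\<lambda>\<omega>. (norm (Y j \<omega>))\<^sup>2)"
    and m: "\<And>j. (\<integral>\<omega>. (norm (Y j \<omega>))\<^sup>2 \<partial>M) \<le> m"
  shows "integrable M (\<lambda>\<omega>. (norm (\<Sum>j. A j (Y j \<omega>)))\<^sup>2)"
proof -
  have [measurable]: "(\<lambda>\<omega>. A j (Y j \<omega>)) \<in> borel_measurable M" for j
    by (rule measurable_compose[OF assms(2)])
      (intro borel_measurable_continuous_onI continuous_intros)
  let ?S = "\<lambda>\<omega>. \<Sum>j. norm (A j) * (norm (Y j \<omega>))\<^sup>2"
  \<comment> \<open>The sum is computed in \<open>ennreal\<close> first, because almost sure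
    convergence of the real series is deduced from the finiteness of this integral.\<close>
  have "(\<integral>\<^sup>+\<omega>. (\<Sum>j. ennreal (norm (A j) * (norm (Y j \<omega>))\<^sup>2)) \<partial>M) =
      (\<Sum>j. \<integral>\<^sup>+\<omega>. ennreal (norm (A j) * (norm (Y j \<omega>))\<^sup>2) \<partial>M)"
    by (rule nn_integral_suminf) measurable
  also have "\<dots> = (\<Sum>j. ennreal (norm (A j) * (\<integral>\<omega>. (norm (Y j \<omega>))\<^sup>2 \<partial>M)))"
    by (intro suminf_cong) (subst nn_integral_eq_integral, auto intro: Y)
  also have "\<dots> \<le> (\<Sum>j. ennreal (norm (A j) * m))"
    by (intro suminf_le ennreal_leI mult_left_mono m) auto
  also have "\<dots> = ennreal (\<Sum>j. norm (A j) * m)"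
  proof -
    have "0 \<le> m" by (rule order_trans[OF _ m[of 0]]) simp
    then show ?thesis
      by (intro suminf_ennreal2) (auto intro!: summable_mult2 A)
  qed
  also have "\<dots> < \<infinity>" by simp
  finally have fin: "(\<integral>\<^sup>+\<omega>. (\<Sum>j. ennreal (norm (A j) * (norm (Y j \<omega>))\<^sup>2)) \<partial>M) < \<infinity>" .
  then have "AE \<omega> in M. (\<Sum>j. ennreal (norm (A j) * (norm (Y j \<omega>))\<^sup>2)) \<noteq> \<infinity>"
    by (intro nn_integral_noteq_infinite) auto
  then have summ: "AE \<omega> in M. summable (\<lambda>j. norm (A j) * (norm (Y j \<omega>))\<^sup>2)"
    by eventually_elim (rule summable_suminf_not_top, auto)
  have "integrable M ?S"
  proof (rule integrableI_bounded)
    \<comment> \<open>Where the real series diverges, \<open>?S\<close> has an unspecified value;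
      the two integrands are therefore compared only almost everywhere.\<close>
    have "(\<integral>\<^sup>+\<omega>. ennreal (norm (?S \<omega>)) \<partial>M) = (\<integral>\<^sup>+\<omega>. (\<Sum>j. ennreal (norm (A j) * (norm (Y j \<omega>))\<^sup>2)) \<partial>M)"
    proof (rule nn_integral_cong_AE, use summ in eventually_elim)
      fix \<omega> assume s: "summable (\<lambda>j. norm (A j) * (norm (Y j \<omega>))\<^sup>2)"
      have "0 \<le> ?S \<omega>" by (intro suminf_nonneg s) auto
      then show "ennreal (norm (?S \<omega>)) = (\<Sum>j. ennreal (norm (A j) * (norm (Y j \<omega>))\<^sup>2))"
        by (subst suminf_ennreal2[OF _ s]) auto
    qed
    then show "(\<integral>\<^sup>+\<omega>. ennreal (norm (?S \<omega>)) \<partial>M) < \<infinity>" using fin by simp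
  qed measurable
  then have "integrable M (\<lambda>\<omega>. (\<Sum>j. norm (A j)) * ?S \<omega>)" by simp
  then show ?thesis
  proof (rule Bochner_Integration.integrable_bound)
    show "AE \<omega> in M. norm ((norm (\<Sum>j. A j (Y j \<omega>)))\<^sup>2) \<le> norm ((\<Sum>j. norm (A j)) * ?S \<omega>)"
      using summ by eventually_elim (use norm_suminf_square_le[OF A] in fastforce)
  qed measurable
qed

text \<open>Each new term is independent of the sum of the others and both are centred, so the cross
  term has expectation 0. Integrability and value go through the induction together.\<close>

lemma (in prob_space) expectation_square_sum_indep:
  fixes u :: "'i \<Rightarrow> 'a \<Rightarrow> real"
  assumes "finite I" and ind: "indep_vars (\<lambda>_. borel) u I"
    and sq: "\<And>i. i \<in> I \<Longrightarrow> integrable M (\<lambda>\<omega>. (u i \<omega>)\<^sup>2)"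
    and mean: "\<And>i. i \<in> I \<Longrightarrow> expectation (u i) = 0"
  shows "integrable M (\<lambda>\<omega>. (\<Sum>i\<in>I. u i \<omega>)\<^sup>2)"
    and "expectation (\<lambda>\<omega>. (\<Sum>i\<in>I. u i \<omega>)\<^sup>2) = (\<Sum>i\<in>I. expectation (\<lambda>\<omega>. (u i \<omega>)\<^sup>2))"
proof -
  have "integrable M (\<lambda>\<omega>. (\<Sum>i\<in>I. u i \<omega>)\<^sup>2) \<and>
     expectation (\<lambda>\<omega>. (\<Sum>i\<in>I. u i \<omega>)\<^sup>2) = (\<Sum>i\<in>I. expectation (\<lambda>\<omega>. (u i \<omega>)\<^sup>2))"
    using assms
  proof (induction I)
    case empty
    then show ?case by simp
  next
    case (insert i I)
    let ?S = "\<lambda>\<omega>. \<Sum>i\<in>I. u i \<omega>"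
    have IH: "integrable M (\<lambda>\<omega>. (?S \<omega>)\<^sup>2)"
      "expectation (\<lambda>\<omega>. (?S \<omega>)\<^sup>2) = (\<Sum>i\<in>I. expectation (\<lambda>\<omega>. (u i \<omega>)\<^sup>2))"
      using insert.IH indep_vars_subset[OF insert.prems(1)] insert.prems by auto
    have rv: "u j \<in> borel_measurable M" if "j \<in> insert i I" for j
      using insert.prems(1) that by (auto simp: indep_vars_def)
    have int: "integrable M (u j)" if "j \<in> insert i I" for j
      using square_integrable_imp_integrable[OF rv insert.prems(2)] that by blast
    have intS: "integrable M ?S" using int by auto
    have ind: "indep_var borel (u i) borel ?S"
      using indep_vars_sum[of I i u] insert by simp
    have prod: "integrable M (\<lambda>\<omega>. u i \<omega> * ?S \<omega>)" "expectation (\<lambda>\<omega>. u i \<omega> * ?S \<omega>) = 0"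
      using indep_var_integrable[OF ind int intS] indep_var_lebesgue_integral[OF ind int intS] insert.prems(3)
      by auto
    have expand: "(\<Sum>j\<in>insert i I. u j \<omega>)\<^sup>2 = (u i \<omega>)\<^sup>2 + 2 * (u i \<omega> * ?S \<omega>) + (?S \<omega>)\<^sup>2" for \<omega>
      using insert.hyps by (simp add: power2_sum algebra_simps)
    show ?case
      unfolding expand using insert.hyps insert.prems(2)[of i] IH prod by simp
  qed
  then show "integrable M (\<lambda>\<omega>. (\<Sum>i\<in>I. u i \<omega>)\<^sup>2)"
    "expectation (\<lambda>\<omega>. (\<Sum>i\<in>I. u i \<omega>)\<^sup>2) = (\<Sum>i\<in>I. expectation (\<lambda>\<omega>. (u i \<omega>)\<^sup>2))"
    by auto
qed

section \<open>Bounded operators on random elements, and tails of series\<close>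

lemma measurable_blinfun_apply:
  fixes f :: "'a::{real_normed_vector, second_countable_topology} \<Rightarrow>\<^sub>L 'b::real_normed_vector"
  assumes "Y \<in> borel_measurable M"
  shows "(\<lambda>\<omega>. f (Y \<omega>)) \<in> borel_measurable M"
  by (rule measurable_compose[OF assms])
    (intro borel_measurable_continuous_onI continuous_intros)

lemma square_integrable_blinfun_apply:
  fixes f :: "'a::{real_normed_vector, second_countable_topology} \<Rightarrow>\<^sub>L 'b::{real_normed_vector, second_countable_topology}"
  assumes "Y \<in> borel_measurable M" "integrable M (\<lambda>\<omega>. (norm (Y \<omega>))\<^sup>2)"
  shows "integrable M (\<lambda>\<omega>. (norm (f (Y \<omega>)))\<^sup>2)"
proof (rule Bochner_Integration.integrable_bound)
  show "integrable M (\<lambda>\<omega>. (norm f)\<^sup>2 * (norm (Y \<omega>))\<^sup>2)" using assms by simp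
  show "(\<lambda>\<omega>. (norm (f (Y \<omega>)))\<^sup>2) \<in> borel_measurable M"
    using measurable_blinfun_apply[OF assms(1)] by measurable
  show "AE \<omega> in M. norm ((norm (f (Y \<omega>)))\<^sup>2) \<le> norm ((norm f)\<^sup>2 * (norm (Y \<omega>))\<^sup>2)"
    by (rule AE_I2) (simp add: norm_blinfun power_mono flip: power_mult_distrib)
qed

text \<open>In the sum of all tails, the term of index \<open>i\<close> is counted once for each
  \<open>j < i\<close>, that is \<open>i\<close> times, which is the weight in the hypothesis. This
  makes the coefficients of the Beveridge-Nelson noise summable.\<close>

lemma summable_norm_tails:
  fixes \<Theta> :: "nat \<Rightarrow> 'a::banach"
  assumes "summable (\<lambda>j. real j * norm (\<Theta> j))"
  shows "summable (\<lambda>j. norm (\<Sum>k. \<Theta> (j + 1 + k)))"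
proof -
  define a where "a j = norm (\<Theta> j)" for j
  have a0: "a j \<ge> 0" for j by (simp add: a_def)
  have ja: "summable (\<lambda>j. real j * a j)" using assms by (simp add: a_def)
  have "summable a"
  \<comment> \<open>The comparison starts at 1, since the weight vanishes at index 0.\<close>
  proof (rule summable_comparison_test'[OF ja, of 1])
    fix n :: nat assume "1 \<le> n"
    then show "norm (a n) \<le> real n * a n" using mult_right_mono[of 1 "real n" "a n"] a0 by simp
  qed
  then have tail: "summable (\<lambda>k. a (j + 1 + k))" for j
    using summable_ignore_initial_segment[of a "j + 1"] by (simp add: add.commute)
  define T where "T j = (\<Sum>k. a (j + 1 + k))" for j
  have T_Suc: "T j = a (Suc j) + T (Suc j)" for j
    unfolding T_def using suminf_split_head[OF tail, of j] by simp
  \<comment> \<open>Summation by parts; \<open>real n * T n\<close> is the boundary term left by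
    truncation.\<close>
  have abel: "(\<Sum>j<n. T j) = (\<Sum>i<Suc n. real i * a i) + real n * T n" for n
  proof (induction n)
    case (Suc n)
    have "(\<Sum>j<Suc n. T j) = (\<Sum>i<Suc n. real i * a i) + (real n + 1) * T n"
      using Suc by (simp add: algebra_simps)
    then show ?case using T_Suc[of n] by (simp add: algebra_simps)
  qed simp
  have "(\<Sum>j<n. T j) \<le> (\<Sum>i. real i * a i)" for n
  proof -
    \<comment> \<open>The boundary term fits under the remainder of the weighted series, all of
      whose indices exceed \<open>n\<close>.\<close>
    have "real n * T n = (\<Sum>k. real n * a (n + 1 + k))"
      unfolding T_def by (rule suminf_mult[OF tail, symmetric])
    also have "\<dots> \<le> (\<Sum>k. real (k + Suc n) * a (k + Suc n))"
    proof (rule suminf_le)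
      show "real n * a (n + 1 + k) \<le> real (k + Suc n) * a (k + Suc n)" for k
        using mult_right_mono[of "real n" "real (k + Suc n)" "a (k + Suc n)"] a0 by (simp add: add.commute)
      show "summable (\<lambda>k. real n * a (n + 1 + k))" by (intro summable_mult tail)
      show "summable (\<lambda>k. real (k + Suc n) * a (k + Suc n))" using ja by (rule summable_ignore_initial_segment)
    qed
    finally show ?thesis
      unfolding abel using suminf_split_initial_segment[OF ja, of "Suc n"] by linarith
  qed
  moreover have "0 \<le> T n" for n
    unfolding T_def by (intro suminf_nonneg tail a0)
  ultimately have T: "summable T"
    by (intro summableI_nonneg_bounded)
  have le: "norm (\<Sum>k. \<Theta> (j + 1 + k)) \<le> T j" for j
    using summable_norm[OF tail[unfolded a_def]] by (simp add: T_def a_def)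
  show ?thesis
    by (rule summable_comparison_test'[OF T, of 0]) (simp only: real_norm_def abs_norm_cancel le)
qed


section \<open>The cointegrating space\<close>

text \<open>The noise at time \<open>t\<close> is one functional \<open>F\<close> of the path
  shifted by \<open>t\<close>, reading only the coordinates \<open>- int j\<close>. Measurability of
  a series of measurable terms holds regardless of convergence.\<close>

lemma stationary_BN_noise:
  fixes f :: "'a::{complex_banach, second_countable_topology} \<Rightarrow>\<^sub>L 'c::{banach, second_countable_topology}"
  assumes "prob_space M" "iid M \<epsilon>"
  shows "stationary M (\<lambda>t \<omega>. f (BN_noise \<Theta> \<epsilon> (int t) \<omega>))"
proof -
  define F where "F p = f (- (\<Sum>j. (\<Sum>k. \<Theta> (j + 1 + k)) (p (- int j))))" for p :: "int \<Rightarrow> 'a"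
  have "(\<lambda>p. (\<Sum>k. \<Theta> (j + 1 + k)) (p (- int j))) \<in> borel_measurable (\<Pi>\<^sub>M i\<in>UNIV. borel)" for j
    by (intro measurable_blinfun_apply measurable_component_singleton) simp
  then have "F \<in> borel_measurable (\<Pi>\<^sub>M i\<in>UNIV. borel)"
    unfolding F_def
    by (rule measurable_blinfun_apply[OF borel_measurable_uminus[OF borel_measurable_suminf]])
  from stationary_path_functional[OF assms this] show ?thesis
    by (simp add: F_def BN_noise_def)
qed

text \<open>Evaluation at a point and multiplication by a scalar are continuous, so both pass
  through the series. This puts \<open>f o\<^sub>L long_run \<Theta>\<close> in the dual
  space.\<close>

lemma bounded_clinear_ops_suminf:
  assumes A: "\<And>j. A j \<in> bounded_clinear_ops" and "summable A"
  shows "(\<Sum>j. A j) \<in> bounded_clinear_ops"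
proof -
  have app: "(\<Sum>j. A j) x = (\<Sum>j. A j x)" and summ: "summable (\<lambda>j. A j x)" for x
    using bounded_linear.suminf[OF blinfun.bounded_linear_left \<open>summable A\<close>]
      bounded_linear.summable[OF blinfun.bounded_linear_left \<open>summable A\<close>] by auto
  have "(\<Sum>j. A j) (c *\<^sub>C x) = c *\<^sub>C (\<Sum>j. A j) x" for c x
  proof -
    have bl: "bounded_linear (\<lambda>y::'b. c *\<^sub>C y)"
      by (rule bounded_linear_intro[of _ "cmod c"])
        (auto simp: scaleC_add_right norm_scaleC scaleR_scaleC scaleC_scaleC mult.commute)
    have "(\<Sum>j. A j) (c *\<^sub>C x) = (\<Sum>j. c *\<^sub>C A j x)"
      using A by (simp add: app bounded_clinear_ops_def)
    also have "\<dots> = c *\<^sub>C (\<Sum>j. A j) x"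
      by (simp add: app bounded_linear.suminf[OF bl summ])
    finally show ?thesis .
  qed
  then show ?thesis by (simp add: bounded_clinear_ops_def)
qed

text \<open>The walk has second moment \<open>t * v\<close> at time \<open>t\<close>, which stays
  below \<open>K\<close> for all \<open>t\<close> only if \<open>v\<close> is not positive.\<close>

lemma (in prob_space) L2_bounded_random_walk_trivial:
  fixes u :: "int \<Rightarrow> 'a \<Rightarrow> real"
  assumes ind: "indep_vars (\<lambda>_. borel) u UNIV"
    and sq: "\<And>s. integrable M (\<lambda>\<omega>. (u s \<omega>)\<^sup>2)"
    and mean: "\<And>s. expectation (u s) = 0"
    and var: "\<And>s. expectation (\<lambda>\<omega>. (u s \<omega>)\<^sup>2) = v"
    and bound: "\<And>t::nat. expectation (\<lambda>\<omega>. (\<Sum>s=1..int t. u s \<omega>)\<^sup>2) \<le> K"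
  shows "AE \<omega> in M. u s \<omega> = 0"
proof -
  have "real t * v \<le> K" for t
    using bound[of t] expectation_square_sum_indep(2)[OF _ indep_vars_subset[OF ind subset_UNIV] sq mean, of "{1..int t}"]
    by (simp add: var)
  then have "v \<le> 0" using reals_Archimedean3 by (meson not_less)
  moreover have "0 \<le> v" by (subst var[of s, symmetric]) simp
  ultimately have "expectation (\<lambda>\<omega>. (u s \<omega>)\<^sup>2) = 0" using var by simp
  then show ?thesis by (subst (asm) integral_nonneg_eq_0_iff_AE[OF sq]) auto
qed

text \<open>The identity and complex conjugation both fix 0, so this treats the two choices of
  \<sigma> at once.\<close>

lemma covariance_eq_0:
  fixes f :: "'b::{complex_banach, second_countable_topology} \<Rightarrow>\<^sub>L complex"
  assumes "AE \<omega> in M. f (Y \<omega>) = 0" and "\<sigma> 0 = 0"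
  shows "covariance \<sigma> M Y f = 0"
proof -
  have "0 *\<^sub>C x = 0" for x :: 'b
    using norm_scaleC[of 0 x] by simp
  with assms have "AE \<omega> in M. \<sigma> (f (Y \<omega>)) *\<^sub>C Y \<omega> = 0"
    by auto
  then show ?thesis unfolding covariance_def by (rule integral_eq_zero_AE)
qed

text \<open>The factor 3 comes from the nonnegative sum of the pairwise squared differences of the
  norms.\<close>

lemma norm_add3_square_le:
  fixes a b c :: "'a::real_normed_vector"
  shows "(norm (a + b + c))\<^sup>2 \<le> 3 * ((norm a)\<^sup>2 + (norm b)\<^sup>2 + (norm c)\<^sup>2)"
proof -
  have "norm (a + b + c) \<le> norm a + norm b + norm c"
    using norm_triangle_ineq[of "a + b" c] norm_triangle_ineq[of a b] by linarith
  then have "(norm (a + b + c))\<^sup>2 \<le> (norm a + norm b + norm c)\<^sup>2"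
    by (rule power_mono) simp
  also have "\<dots> \<le> 3 * ((norm a)\<^sup>2 + (norm b)\<^sup>2 + (norm c)\<^sup>2)"
  proof -
    have "0 \<le> (norm a - norm b)\<^sup>2 + (norm a - norm c)\<^sup>2 + (norm b - norm c)\<^sup>2" by simp
    then show ?thesis by (simp add: power2_eq_square algebra_simps)
  qed
  finally show ?thesis .
qed

text \<open>The joint law of \<tau> and the innovations is unknown, so the random walk is isolated
  algebraically and bounded through the separate second moments of the three remaining
  terms.\<close>

lemma cointegrating_space_subset_annihilator:
  fixes \<epsilon> :: "int \<Rightarrow> 'w \<Rightarrow> 'b::{complex_banach, second_countable_topology}"
  assumes "prob_space M" and \<sigma>: "\<sigma> 0 = 0"
    and eL2: "\<And>t. \<epsilon> t \<in> L2_mean_zero M" and iid: "iid M \<epsilon>" and pd: "pos_def_covariance \<sigma> M (\<epsilon> 0)"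
    and clin: "\<And>j. \<Theta> j \<in> bounded_clinear_ops" and summ: "summable \<Theta>"
    and tails: "summable (\<lambda>j. norm (\<Sum>k. \<Theta> (j + 1 + k)))"
  shows "cointegrating_space M \<Theta> \<epsilon> \<subseteq> annihilator (attractor_space \<Theta>)"
proof
  interpret prob_space M by fact
  fix f assume "f \<in> cointegrating_space M \<Theta> \<epsilon>"
  then obtain \<tau> where f: "f \<in> dual_space" and \<tau>: "\<tau> \<in> L2_mean_zero M"
    and stat: "stationary M (\<lambda>t \<omega>. f (BN_representation \<Theta> \<epsilon> \<tau> t \<omega>))"
    by (auto simp: cointegrating_space_def)
  define g where "g = f o\<^sub>L long_run \<Theta>"
  have g_dual: "g \<in> dual_space"
    using f bounded_clinear_ops_suminf[OF clin summ]
    by (simp add: g_def long_run_def dual_space_def bounded_clinear_ops_def)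
  have e_meas: "\<epsilon> t \<in> borel_measurable M" and e_sq: "integrable M (\<lambda>\<omega>. (norm (\<epsilon> t \<omega>))\<^sup>2)"
    and e_mean: "(\<integral>\<omega>. \<epsilon> t \<omega> \<partial>M) = 0" for t
    using eL2[of t] by (auto simp: L2_mean_zero_def)
  have e_int: "integrable M (\<epsilon> t)" for t
    using square_integrable_imp_integrable[of "\<lambda>\<omega>. norm (\<epsilon> t \<omega>)"] e_meas[of t] e_sq[of t]
    by (simp add: integrable_norm_iff)
  \<comment> \<open>Equal laws of the innovations give equal expectations of any Borel function of
    them.\<close>
  have e_transfer: "expectation (\<lambda>\<omega>. \<phi> (\<epsilon> s \<omega>)) = expectation (\<lambda>\<omega>. \<phi> (\<epsilon> t \<omega>))"
    if "\<phi> \<in> borel_measurable borel" for \<phi> :: "'b \<Rightarrow> real" and s t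
    using iid that unfolding iid_def by (metis e_meas integral_distr)
  define Y where "Y t \<omega> = f (BN_representation \<Theta> \<epsilon> \<tau> t \<omega>)" for t \<omega>
  define N where "N t \<omega> = f (BN_noise \<Theta> \<epsilon> (int t) \<omega>)" for t \<omega>
  have Y_stat: "stationary M Y" using stat by (simp add: Y_def[abs_def])
  have N_stat: "stationary M N" using stationary_BN_noise[OF \<open>prob_space M\<close> iid] by (simp add: N_def[abs_def])
  have [measurable]: "Y t \<in> borel_measurable M" "N t \<in> borel_measurable M" for t
    using Y_stat N_stat by (simp_all add: stationary_def)
  have \<tau>_meas: "(\<lambda>\<omega>. f (\<tau> \<omega>)) \<in> borel_measurable M" and \<tau>_sq: "integrable M (\<lambda>\<omega>. (norm (f (\<tau> \<omega>)))\<^sup>2)"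
    using \<tau> by (auto simp: L2_mean_zero_def intro: measurable_blinfun_apply square_integrable_blinfun_apply)
  note \<tau>_meas[measurable]
  have walk: "g (\<Sum>s=1..int t. \<epsilon> s \<omega>) = Y t \<omega> - f (\<tau> \<omega>) - N t \<omega>" for t \<omega>
    by (simp add: Y_def N_def g_def BN_representation_def blinfun.add_right)
  have N0_sq: "integrable M (\<lambda>\<omega>. (norm (N 0 \<omega>))\<^sup>2)"
  proof -
    \<comment> \<open>The uniform moment bound is the common second moment, represented by that of
      \<open>\<epsilon> 0\<close>.\<close>
    have "integrable M (\<lambda>\<omega>. (norm (\<Sum>j. (\<Sum>k. \<Theta> (j + 1 + k)) (\<epsilon> (- int j) \<omega>)))\<^sup>2)"
      by (rule square_integrable_weighted_series[OF tails e_meas e_sq])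
        (rule eq_refl[OF e_transfer[of "\<lambda>x. (norm x)\<^sup>2" _ 0]], measurable)
    moreover have "(\<lambda>\<omega>. \<Sum>j. (\<Sum>k. \<Theta> (j + 1 + k)) (\<epsilon> (- int j) \<omega>)) \<in> borel_measurable M"
      by (intro borel_measurable_suminf measurable_blinfun_apply e_meas)
    ultimately show ?thesis
      using square_integrable_blinfun_apply[of _ M f]
      by (simp add: N_def BN_noise_def blinfun.minus_right)
  qed
  \<comment> \<open>At time 0 the walk is an empty sum, so \<open>Y 0\<close> is built from \<tau>
    and the noise alone; stationarity spreads square integrability to all times.\<close>
  have Y0_sq: "integrable M (\<lambda>\<omega>. (norm (Y 0 \<omega>))\<^sup>2)"
  proof (rule Bochner_Integration.integrable_bound)
    show "integrable M (\<lambda>\<omega>. 3 * ((norm (f (\<tau> \<omega>)))\<^sup>2 + (norm (N 0 \<omega>))\<^sup>2))"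
      using \<tau>_sq N0_sq by simp
    have "Y 0 \<omega> = f (\<tau> \<omega>) + N 0 \<omega> + 0" for \<omega>
      using walk[of \<omega> 0] by (simp add: algebra_simps)
    then have "(norm (Y 0 \<omega>))\<^sup>2 \<le> 3 * ((norm (f (\<tau> \<omega>)))\<^sup>2 + (norm (N 0 \<omega>))\<^sup>2)" for \<omega>
      using norm_add3_square_le[of "f (\<tau> \<omega>)" "N 0 \<omega>" 0] by simp
    then show "AE \<omega> in M. norm ((norm (Y 0 \<omega>))\<^sup>2) \<le>
        norm (3 * ((norm (f (\<tau> \<omega>)))\<^sup>2 + (norm (N 0 \<omega>))\<^sup>2))"
      by (intro AE_I2) (auto intro: order_trans[OF _ abs_ge_self])
  qed measurable
  let ?W = "\<lambda>t \<omega>. g (\<Sum>s=1..int t. \<epsilon> s \<omega>)"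
  \<comment> \<open>This dominates the squared walk, and its expectation \<open>K\<close> does not
    depend on \<open>t\<close>.\<close>
  let ?D = "\<lambda>t \<omega>. 3 * ((norm (Y t \<omega>))\<^sup>2 + (norm (f (\<tau> \<omega>)))\<^sup>2 + (norm (N t \<omega>))\<^sup>2)"
  note Y_sq = stationary_second_moment[OF Y_stat Y0_sq] and N_sq = stationary_second_moment[OF N_stat N0_sq]
  have D_int: "integrable M (?D t)" for t
    using Y_sq(1) \<tau>_sq N_sq(1) by simp
  have W_le: "(norm (?W t \<omega>))\<^sup>2 \<le> ?D t \<omega>" for t \<omega>
    using norm_add3_square_le[of "Y t \<omega>" "- f (\<tau> \<omega>)" "- N t \<omega>"] by (simp add: walk)
  define K where "K = expectation (?D 0)"
  have D_exp: "expectation (?D t) = K" for t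
    unfolding K_def using Y_sq(1) \<tau>_sq N_sq(1) by (simp add: Y_sq(2)[of t] N_sq(2)[of t])
  \<comment> \<open>The growth argument concerns real variables, so it is run for the real and
    imaginary parts; neither exceeds the modulus, so both inherit the bound
    \<open>K\<close>.\<close>
  have coord: "AE \<omega> in M. L (g (\<epsilon> 0 \<omega>)) = 0"
    if "bounded_linear L" and L: "\<And>z. \<bar>L z\<bar> \<le> cmod z" for L :: "complex \<Rightarrow> real"
  proof -
    interpret L: bounded_linear L by fact
    define l where "l = Blinfun L o\<^sub>L g"
    have l: "l x = L (g x)" for x by (simp add: l_def bounded_linear_Blinfun_apply L.bounded_linear_axioms)
    have l_meas: "blinfun_apply l \<in> borel_measurable borel"
      by (intro measurable_blinfun_apply) simp
    have ll_meas: "(\<lambda>x. (l x)\<^sup>2) \<in> borel_measurable borel"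
      using l_meas by measurable
    have "AE \<omega> in M. l (\<epsilon> 0 \<omega>) = 0"
    proof (rule L2_bounded_random_walk_trivial)
      show "indep_vars (\<lambda>_. borel) (\<lambda>s \<omega>. l (\<epsilon> s \<omega>)) UNIV"
        using iid l_meas unfolding iid_def by (intro indep_vars_compose2[where Y = "\<lambda>_. blinfun_apply l"]) auto
      show "integrable M (\<lambda>\<omega>. (l (\<epsilon> s \<omega>))\<^sup>2)" for s
        using square_integrable_blinfun_apply[OF e_meas e_sq, of l s] by simp
      show "expectation (\<lambda>\<omega>. l (\<epsilon> s \<omega>)) = 0" for s
        using integral_bounded_linear[OF blinfun.bounded_linear_right e_int, of l s]
        by (simp add: e_mean blinfun.zero_right)
      show "expectation (\<lambda>\<omega>. (l (\<epsilon> s \<omega>))\<^sup>2) = expectation (\<lambda>\<omega>. (l (\<epsilon> 0 \<omega>))\<^sup>2)" for s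
        by (rule e_transfer[OF ll_meas])
      fix t :: nat
      have "(\<Sum>s=1..int t. l (\<epsilon> s \<omega>))\<^sup>2 \<le> ?D t \<omega>" for \<omega>
      proof -
        have "(\<Sum>s=1..int t. l (\<epsilon> s \<omega>))\<^sup>2 = (L (?W t \<omega>))\<^sup>2"
          by (simp add: l blinfun.sum_right L.sum)
        also have "\<dots> \<le> (norm (?W t \<omega>))\<^sup>2"
          using L[of "?W t \<omega>"] unfolding abs_le_square_iff[symmetric] by simp
        finally show ?thesis using W_le by (rule order_trans)
      qed
      then have "expectation (\<lambda>\<omega>. (\<Sum>s=1..int t. l (\<epsilon> s \<omega>))\<^sup>2) \<le> expectation (?D t)"
        by (intro integral_mono' D_int) auto
      then show "expectation (\<lambda>\<omega>. (\<Sum>s=1..int t. l (\<epsilon> s \<omega>))\<^sup>2) \<le> K"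
        by (simp only: D_exp)
    qed
    then show ?thesis by (simp add: l)
  qed
  have "AE \<omega> in M. Re (g (\<epsilon> 0 \<omega>)) = 0" "AE \<omega> in M. Im (g (\<epsilon> 0 \<omega>)) = 0"
    by (intro coord bounded_linear_Re bounded_linear_Im abs_Re_le_cmod abs_Im_le_cmod)+
  then have "AE \<omega> in M. g (\<epsilon> 0 \<omega>) = 0"
    by eventually_elim (simp add: complex_eq_iff)
  \<comment> \<open>Positive definiteness is tested at \<open>g\<close>, the composite with the
    long-run operator, rather than at \<open>f\<close>.\<close>
  then have "covariance \<sigma> M (\<epsilon> 0) g = 0"
    using \<sigma> by (rule covariance_eq_0)
  then have "g = 0"
    using pd g_dual by (simp add: pos_def_covariance_def blinfun.zero_right)
  then have "f (long_run \<Theta> x) = 0" for x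
    unfolding g_def by (metis blinfun_apply_blinfun_compose zero_blinfun.rep_eq)
  then show "f \<in> annihilator (attractor_space \<Theta>)"
    using f by (auto simp: annihilator_def attractor_space_def)
qed

lemma annihilator_subset_cointegrating_space:
  assumes "prob_space M" "iid M \<epsilon>"
  shows "annihilator (attractor_space \<Theta>) \<subseteq> cointegrating_space M \<Theta> \<epsilon>"
proof
  fix f assume f: "f \<in> annihilator (attractor_space \<Theta>)"
  have "f (BN_representation \<Theta> \<epsilon> (\<lambda>_. 0) t \<omega>) = f (BN_noise \<Theta> \<epsilon> (int t) \<omega>)" for t \<omega>
    using f by (simp add: annihilator_def attractor_space_def BN_representation_def blinfun.add_right)
  then have "stationary M (\<lambda>t \<omega>. f (BN_representation \<Theta> \<epsilon> (\<lambda>_. 0) t \<omega>))"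
    using stationary_BN_noise[OF assms] by simp
  moreover have "(\<lambda>_. 0) \<in> L2_mean_zero M"
    by (simp add: L2_mean_zero_def)
  ultimately show "f \<in> cointegrating_space M \<Theta> \<epsilon>"
    using f unfolding cointegrating_space_def annihilator_def by blast
qed

text \<open>The unique existence clause is what entitles one to speak of the projection onto
  \<open>V\<close>; closedness of \<open>V\<close> enters there.\<close>

theorem proposition2p1:
  fixes M :: "'w measure"
    and \<sigma> :: "complex \<Rightarrow> complex"
    and d :: nat
    and \<Theta> :: "nat \<Rightarrow> 'b::{complex_banach, second_countable_topology} \<Rightarrow>\<^sub>L 'b"
    and \<epsilon> X :: "int \<Rightarrow> 'w \<Rightarrow> 'b"
  assumes "prob_space M"
    and "\<sigma> = id \<or> \<sigma> = cnj"
    and "d \<in> {1, 2}"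
    and "integrated_process \<sigma> M d \<Theta> \<epsilon> X"
  shows "cointegrating_space M \<Theta> \<epsilon> = annihilator (attractor_space \<Theta>) \<and>
    (\<forall>V. closed V \<and> direct_sum_decomp (closure (attractor_space \<Theta>)) V \<longrightarrow>
      (\<exists>!P. is_projection_along P V (closure (attractor_space \<Theta>))) \<and>
      (\<forall>P. is_projection_along P V (closure (attractor_space \<Theta>)) \<longrightarrow>
        cointegrating_space M \<Theta> \<epsilon> = {f o\<^sub>L P | f. f \<in> dual_space}))"
proof -
  interpret prob_space M by fact
  have eL2: "\<epsilon> t \<in> L2_mean_zero M" and iid: "iid M \<epsilon>" and pd: "pos_def_covariance \<sigma> M (\<epsilon> 0)"
    and clin: "\<Theta> j \<in> bounded_clinear_ops" and summ: "summable (\<lambda>j. real j ^ d * norm (\<Theta> j))" for t j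
    using assms(4) by (auto simp: integrated_process_def)
  \<comment> \<open>Both orders of integration reduce to the weight \<open>real j\<close>; at
    \<open>j = 0\<close> the two sides vanish because \<open>d\<close> is positive.\<close>
  have d: "real j \<le> real j ^ d" for j
    using assms(3) by (cases j) (auto simp: power2_eq_square)
  have summ1: "summable (\<lambda>j. real j * norm (\<Theta> j))"
    by (rule summable_comparison_test'[OF summ, of 0]) (simp, rule mult_right_mono[OF d norm_ge_zero])
  have "summable (\<lambda>j. norm (\<Theta> j))"
  proof (rule summable_comparison_test'[OF summ1, of 1])
    fix n :: nat assume "1 \<le> n"
    then show "norm (norm (\<Theta> n)) \<le> real n * norm (\<Theta> n)"
      using mult_right_mono[of 1 "real n" "norm (\<Theta> n)"] by simp
  qed
  then have summ0: "summable \<Theta>" by (rule summable_norm_cancel)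
  have \<sigma>: "\<sigma> 0 = 0" using assms(2) by auto
  have C: "cointegrating_space M \<Theta> \<epsilon> = annihilator (attractor_space \<Theta>)"
  proof (rule antisym)
    show "cointegrating_space M \<Theta> \<epsilon> \<subseteq> annihilator (attractor_space \<Theta>)"
      by (rule cointegrating_space_subset_annihilator[OF assms(1) \<sigma> eL2 iid pd clin summ0 summable_norm_tails[OF summ1]])
    show "annihilator (attractor_space \<Theta>) \<subseteq> cointegrating_space M \<Theta> \<epsilon>"
      by (rule annihilator_subset_cointegrating_space[OF assms(1) iid])
  qed
  show ?thesis
  \<comment> \<open>Given (i), the second claim is a statement about annihilators and projections
    only.\<close>
  proof (intro conjI allI impI)
    fix V assume "closed V \<and> direct_sum_decomp (closure (attractor_space \<Theta>)) V"
    then show "\<exists>!P. is_projection_along P V (closure (attractor_space \<Theta>))"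
      using direct_sum_projection_exists[OF closed_closure] projection_along_unique by metis
  next
    fix V P assume "is_projection_along P V (closure (attractor_space \<Theta>))"
    then show "cointegrating_space M \<Theta> \<epsilon> = {f o\<^sub>L P | f. f \<in> dual_space}"
      unfolding C by (rule annihilator_eq_compose_projection)
  qed (rule C)
qed

end
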